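(* Let $\Gamma$ be an infinite finitely generated abelian group and $F\colon\Gamma\to\Gamma$ an injective endomorphism. Then $\Gamma$ admits an $F^r$-spanning set for some $r>0$ if and only if all eigenvalues of the $\mathbb{C}$-linear map $F\otimes_{\mathbb{Z}}\mathrm{id}_{\mathbb{C}}$ on $\Gamma\otimes_{\mathbb{Z}}\mathbb{C}$ have modulus $>1$.
   Context: For a string $\sigma=s_0s_1\cdots s_n$ of elements of $\Gamma$ and an endomorphism $G$ of $\Gamma$, write $[\sigma]_G=s_0+Gs_1+\cdots+G^ns_n$. For a finite set $\Lambda$, $\Lambda^*$ is the set of finite strings over $\Lambda$. A finite set $\Sigma\subseteq\Gamma$ is a $G$-spanning set if: (i) every $a\in\Gamma$ equals $[\sigma]_G$ for some $\sigma\in\Sigma^*$; (ii) $0\in\Sigma$ and $a\in\Sigma\Rightarrow -a\in\Sigma$; (iii) if $a_1,\dots,a_5\in\Sigma$ then $a_1+\cdots+a_5\in\Sigma+G\Sigma$; (iv) if $a_1,a_2,a_3\in\Sigma$ and $a_1+a_2+a_3\in G\Gamma$ then $a_1+a_2+a_3\in G\Sigma$. *)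

theory Defs
  imports
    Complex_Main
    "HOL-Library.Poly_Mapping"
    "HOL-Computational_Algebra.Group_Closure"
begin

section \<open>The tensor product of two abelian groups\<close>

text \<open>
  The tensor product over the integers is the free abelian group on the set of pairs, modulo the
  subgroup generated by the relators that make the pairing biadditive.
\<close>

definition tensor_relators :: "('a::ab_group_add \<times> 'b::ab_group_add \<Rightarrow>\<^sub>0 int) set" where
  "tensor_relators =
     {frag_of (a + a', b) - frag_of (a, b) - frag_of (a', b) | a a' b. True} \<union>
     {frag_of (a, b + b') - frag_of (a, b) - frag_of (a, b') | a b b'. True}"

definition tensor_rel ::
  "('a::ab_group_add \<times> 'b::ab_group_add \<Rightarrow>\<^sub>0 int) \<Rightarrow> ('a \<times> 'b \<Rightarrow>\<^sub>0 int) \<Rightarrow> bool" where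
  "tensor_rel x y \<longleftrightarrow> x - y \<in> group_closure tensor_relators"

lemma equivp_tensor_rel:
  "equivp (tensor_rel :: ('a::ab_group_add \<times> 'b::ab_group_add \<Rightarrow>\<^sub>0 int) \<Rightarrow> _)"
proof (rule equivpI)
  show "reflp (tensor_rel :: ('a \<times> 'b \<Rightarrow>\<^sub>0 int) \<Rightarrow> _)"
    by (rule reflpI) (simp add: tensor_rel_def)
  show "symp (tensor_rel :: ('a \<times> 'b \<Rightarrow>\<^sub>0 int) \<Rightarrow> _)"
    by (rule sympI) (metis group_closure_minus_iff minus_diff_eq tensor_rel_def)
  show "transp (tensor_rel :: ('a \<times> 'b \<Rightarrow>\<^sub>0 int) \<Rightarrow> _)"
  proof (rule transpI)
    fix x y z :: "'a \<times> 'b \<Rightarrow>\<^sub>0 int"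
    assume "tensor_rel x y" "tensor_rel y z"
    then have "(x - y) + (y - z) \<in> group_closure tensor_relators"
      unfolding tensor_rel_def by (rule group_closure_add)
    then show "tensor_rel x z"
      by (simp add: tensor_rel_def)
  qed
qed

quotient_type (overloaded) ('a, 'b) tensor =
  "('a::ab_group_add \<times> 'b::ab_group_add) \<Rightarrow>\<^sub>0 int" / tensor_rel
  by (rule equivp_tensor_rel)

instantiation tensor :: (ab_group_add, ab_group_add) ab_group_add
begin

lift_definition zero_tensor :: "('a, 'b) tensor" is 0 .

lift_definition plus_tensor :: "('a, 'b) tensor \<Rightarrow> ('a, 'b) tensor \<Rightarrow> ('a, 'b) tensor" is "(+)"
  unfolding tensor_rel_def by (metis add_diff_add group_closure_add)

lift_definition uminus_tensor :: "('a, 'b) tensor \<Rightarrow> ('a, 'b) tensor" is uminus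
  unfolding tensor_rel_def by (metis group_closure_minus_iff minus_diff_minus)

lift_definition minus_tensor :: "('a, 'b) tensor \<Rightarrow> ('a, 'b) tensor \<Rightarrow> ('a, 'b) tensor" is "(-)"
proof (unfold tensor_rel_def)
  fix x x' y y' :: "'a \<times> 'b \<Rightarrow>\<^sub>0 int"
  assume "x - x' \<in> group_closure tensor_relators" "y - y' \<in> group_closure tensor_relators"
  then have "(x - x') - (y - y') \<in> group_closure tensor_relators"
    by (rule group_closure.diff)
  then show "(x - y) - (x' - y') \<in> group_closure tensor_relators"
    by (simp add: algebra_simps)
qed

instance
  by standard (transfer, simp add: tensor_rel_def algebra_simps)+

end

lift_definition tensor_of :: "'a::ab_group_add \<Rightarrow> 'b::ab_group_add \<Rightarrow> ('a, 'b) tensor"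
  is "\<lambda>a b. frag_of (a, b)" .

lemma tensor_of_add_left: "tensor_of (a + a') b = tensor_of a b + tensor_of a' b"
proof (transfer fixing: a a' b)
  have "frag_of (a + a', b) - frag_of (a, b) - frag_of (a', b) \<in> group_closure tensor_relators"
    by (rule group_closure.base, unfold tensor_relators_def) blast
  then show "tensor_rel (frag_of (a + a', b)) (frag_of (a, b) + frag_of (a', b))"
    by (simp add: tensor_rel_def diff_diff_eq)
qed

lemma tensor_of_add_right: "tensor_of a (b + b') = tensor_of a b + tensor_of a b'"
proof (transfer fixing: a b b')
  have "frag_of (a, b + b') - frag_of (a, b) - frag_of (a, b') \<in> group_closure tensor_relators"
    by (rule group_closure.base, unfold tensor_relators_def) blast
  then show "tensor_rel (frag_of (a, b + b')) (frag_of (a, b) + frag_of (a, b'))"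
    by (simp add: tensor_rel_def diff_diff_eq)
qed

lemma tensor_induct [case_names zero tensor_of diff]:
  assumes "P 0" and "\<And>a b. P (tensor_of a b)" and "\<And>x y. P x \<Longrightarrow> P y \<Longrightarrow> P (x - y)"
  shows "P x"
proof -
  have "P (abs_tensor c)" for c
    using subset_UNIV[of "Poly_Mapping.keys c"]
  proof (induction c rule: frag_induction)
    case zero
    then show ?case using assms(1) by (simp add: zero_tensor_def)
  next
    case (one x)
    then show ?case using assms(2)[of "fst x" "snd x"] by (simp add: tensor_of.abs_eq)
  next
    case (diff a b)
    then show ?case using assms(3) by (metis minus_tensor.abs_eq)
  qed
  then show ?thesis by (metis Quotient3_abs_rep Quotient3_tensor)
qed


text \<open>
  The map induced on tensor products by two additive maps, acting on a representative; for
  additive \<open>f\<close> and \<open>g\<close> the choice of representative is immaterial (\<open>tensor_map_abs\<close>).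
\<close>

definition tensor_map ::
  "('a::ab_group_add \<Rightarrow> 'c::ab_group_add) \<Rightarrow> ('b::ab_group_add \<Rightarrow> 'd::ab_group_add) \<Rightarrow>
   ('a, 'b) tensor \<Rightarrow> ('c, 'd) tensor" where
  "tensor_map f g x = abs_tensor (frag_extend (\<lambda>(a, b). frag_of (f a, g b)) (rep_tensor x))"

lemma tensor_rel_frag_extend:
  assumes "additive f" "additive g" "tensor_rel x y"
  shows "tensor_rel (frag_extend (\<lambda>(a, b). frag_of (f a, g b)) x)
                    (frag_extend (\<lambda>(a, b). frag_of (f a, g b)) y)"
proof -
  interpret f: additive f by fact
  interpret g: additive g by fact
  have "frag_extend (\<lambda>(a, b). frag_of (f a, g b)) z \<in> group_closure tensor_relators"
    if "z \<in> group_closure tensor_relators" for z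
    using that
  proof induction
    case (base s)
    then show ?case
    proof (cases "s = 0")
      case False
      with base have "s \<in> tensor_relators" by simp
      then have "frag_extend (\<lambda>(a, b). frag_of (f a, g b)) s \<in> tensor_relators"
        unfolding tensor_relators_def by (fastforce simp: frag_extend_diff f.add g.add)
      then show ?thesis by (simp add: group_closure.base)
    qed simp
  next
    case (diff s t)
    then show ?case by (simp add: frag_extend_diff group_closure.diff)
  qed
  with assms(3) show ?thesis
    by (simp add: tensor_rel_def flip: frag_extend_diff)
qed

lemma tensor_map_abs:
  assumes "additive f" "additive g"
  shows "tensor_map f g (abs_tensor x) =
         abs_tensor (frag_extend (\<lambda>(a, b). frag_of (f a, g b)) x)"
proof -
  have "tensor_rel (rep_tensor (abs_tensor x)) x"
    by (metis Quotient3_tensor Quotient3_rep_abs tensor.abs_eq_iff Quotient3_abs_rep)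
  then show ?thesis
    unfolding tensor_map_def using tensor_rel_frag_extend[OF assms] tensor.abs_eq_iff by blast
qed

lemma tensor_map_tensor_of [simp]:
  assumes "additive f" "additive g"
  shows "tensor_map f g (tensor_of a b) = tensor_of (f a) (g b)"
  by (simp add: tensor_of.abs_eq tensor_map_abs[OF assms])

lemma additive_tensor_map:
  fixes f :: "'a::ab_group_add \<Rightarrow> 'c::ab_group_add" and g :: "'b::ab_group_add \<Rightarrow> 'd::ab_group_add"
  assumes "additive f" "additive g"
  shows "additive (tensor_map f g)"
proof
  fix x y :: "('a, 'b) tensor"
  obtain c d where "x = abs_tensor c" "y = abs_tensor d"
    by (metis Quotient3_abs_rep Quotient3_tensor)
  then show "tensor_map f g (x + y) = tensor_map f g x + tensor_map f g y"
    by (simp add: plus_tensor.abs_eq tensor_map_abs[OF assms] frag_extend_add)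
qed

lemma tensor_additive_eqI:
  assumes "additive h" "additive k" and "\<And>a b. h (tensor_of a b) = k (tensor_of a b)"
  shows "h x = k x"
  by (induction x rule: tensor_induct) (simp_all add: assms additive.zero additive.diff)


section \<open>Complexification of an abelian group\<close>

definition scale_complexification ::
  "complex \<Rightarrow> ('a::ab_group_add, complex) tensor \<Rightarrow> ('a, complex) tensor" where
  "scale_complexification z = tensor_map id ((*) z)"

abbreviation complexification_map ::
  "('a::ab_group_add \<Rightarrow> 'b::ab_group_add) \<Rightarrow> ('a, complex) tensor \<Rightarrow> ('b, complex) tensor" where
  "complexification_map f \<equiv> tensor_map f id"

lemma additive_id: "additive id"
  by (simp add: additive_def)

lemma additive_compose: "additive h \<Longrightarrow> additive k \<Longrightarrow> additive (\<lambda>x. h (k x))"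
  by (simp add: additive_def)

lemma additive_times: "additive ((*) z)" for z :: complex
  by (simp add: additive_def algebra_simps)

lemma additive_scale_complexification: "additive (scale_complexification z)"
  unfolding scale_complexification_def by (intro additive_tensor_map additive_id additive_times)

lemma scale_complexification_tensor_of [simp]:
  "scale_complexification z (tensor_of a w) = tensor_of a (z * w)"
  by (simp add: scale_complexification_def additive_id additive_times)

lemma vector_space_complexification: "vector_space scale_complexification"
proof
  fix z w :: complex and x y :: "('a, complex) tensor"
  show "scale_complexification z (x + y) = scale_complexification z x + scale_complexification z y"
    by (rule additive.add[OF additive_scale_complexification])
  show "scale_complexification (z + w) x = scale_complexification z x + scale_complexification w x"
  proof (rule tensor_additive_eqI[OF additive_scale_complexification])
    show "additive (\<lambda>x::('a, complex) tensor. scale_complexification z x + scale_complexification w x)"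
      by (simp add: additive_def additive.add[OF additive_scale_complexification] algebra_simps)
  qed (simp add: distrib_right tensor_of_add_right)
  show "scale_complexification z (scale_complexification w x) = scale_complexification (z * w) x"
    by (rule tensor_additive_eqI[OF additive_compose]) (simp_all add: additive_scale_complexification mult.assoc)
  show "scale_complexification 1 x = x"
    by (rule tensor_additive_eqI[OF additive_scale_complexification, of "\<lambda>x. x"])
      (simp_all add: additive_def)
qed

lemma linear_complexification_map:
  assumes "additive f"
  shows "Vector_Spaces.linear scale_complexification scale_complexification (complexification_map f)"
proof -
  have add: "additive (complexification_map f)"
    by (intro additive_tensor_map assms additive_id)
  have "complexification_map f (scale_complexification z x) =
        scale_complexification z (complexification_map f x)" for z x
  proof (rule tensor_additive_eqI[where
        h = "\<lambda>x. complexification_map f (scale_complexification z x)" and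
        k = "\<lambda>x. scale_complexification z (complexification_map f x)"])
    show "additive (\<lambda>x. complexification_map f (scale_complexification z x))"
      by (rule additive_compose[OF add additive_scale_complexification])
    show "additive (\<lambda>x. scale_complexification z (complexification_map f x))"
      by (rule additive_compose[OF additive_scale_complexification add])
  qed (simp add: assms additive_id)
  with add show ?thesis
    by (simp add: Vector_Spaces.linear_iff vector_space_complexification additive_def)
qed

definition is_eigenvalue ::
  "('k::field \<Rightarrow> 'v::ab_group_add \<Rightarrow> 'v) \<Rightarrow> ('v \<Rightarrow> 'v) \<Rightarrow> 'k \<Rightarrow> bool" where
  "is_eigenvalue scale T l \<longleftrightarrow> (\<exists>v. v \<noteq> 0 \<and> T v = scale l v)"


section \<open>Spanning sets\<close>

definition finitely_generated :: "'a::ab_group_add itself \<Rightarrow> bool" where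
  "finitely_generated _ \<longleftrightarrow> (\<exists>S :: 'a set. finite S \<and> group_closure S = UNIV)"

text \<open>The value of the empty string is 0.\<close>

definition string_value :: "('a::ab_group_add \<Rightarrow> 'a) \<Rightarrow> 'a list \<Rightarrow> 'a" where
  "string_value G s = (\<Sum>i<length s. (G ^^ i) (s ! i))"

definition spanning_set :: "('a::ab_group_add \<Rightarrow> 'a) \<Rightarrow> 'a set \<Rightarrow> bool" where
  "spanning_set G S \<longleftrightarrow>
     finite S \<and>
     (\<forall>a. \<exists>s \<in> lists S. a = string_value G s) \<and>
     0 \<in> S \<and> (\<forall>a \<in> S. - a \<in> S) \<and>
     (\<forall>a1 \<in> S. \<forall>a2 \<in> S. \<forall>a3 \<in> S. \<forall>a4 \<in> S. \<forall>a5 \<in> S.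
        \<exists>b \<in> S. \<exists>c \<in> S. a1 + a2 + a3 + a4 + a5 = b + G c) \<and>
     (\<forall>a1 \<in> S. \<forall>a2 \<in> S. \<forall>a3 \<in> S. a1 + a2 + a3 \<in> range G \<longrightarrow> a1 + a2 + a3 \<in> G ` S)"

end

theory Submission
  imports "Jordan_Normal_Form.Spectral_Radius" Defs
begin

text \<open>
  Choose a maximal independent family \<open>b\<^sub>1, \<dots>, b\<^sub>d\<close> among the generators. Some positive integer \<open>m\<close>
  moves the whole group into its span, which gives additive integer coordinates with finite fibres
  and balls; in these coordinates both \<open>F\<close> and its complexification act by one rational matrix \<open>A\<close>,
  so the eigenvalues in question are those of \<open>A\<close>.

  If there is a spanning set for \<open>F\<^sup>r\<close> and \<open>A\<close> has an eigenvalue of modulus at most 1, an eigenvector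
  of the transpose of \<open>A\<close> is a nonzero additive functional that grows at most linearly in the length
  of a string. But doubling an element costs only one more digit, whereas it doubles the functional.

  Conversely, if all eigenvalues have modulus greater than 1, the powers of the inverse of \<open>A\<close> tend
  to 0, so some \<open>F\<^sup>r\<close> multiplies the \<open>l\<^sup>1\<close>-norm of the coordinates by at least 6. Every large enough ball
  is then a spanning set: division with remainder by \<open>F\<^sup>r\<close> maps a ball of radius \<open>5 R\<close> to quotients of
  norm at most \<open>(5 R + R) / 6 = R\<close>.
\<close>

section \<open>Integer multiples\<close>

text \<open>Since \<open>nat\<close> truncates negative numbers to 0, at least one of the two
  iterates has exponent 0.\<close>

definition int_scale :: "int \<Rightarrow> 'a::ab_group_add \<Rightarrow> 'a" where
  "int_scale k a = (((+) a) ^^ nat k) 0 - (((+) a) ^^ nat (- k)) 0"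

lemma int_scale_0: "int_scale 0 a = 0"
  by (simp add: int_scale_def)

lemma int_scale_Suc: "int_scale (k + 1) a = int_scale k a + a"
proof (cases "k \<ge> 0")
  case True
  then have "nat (k + 1) = Suc (nat k)" by simp
  with True show ?thesis by (simp add: int_scale_def)
next
  case False
  then have "nat (- k) = Suc (nat (- (k + 1)))" by simp
  with False show ?thesis by (simp add: int_scale_def)
qed

lemma int_scale_pred: "int_scale (k - 1) a = int_scale k a - a"
  using int_scale_Suc[of "k - 1" a] by simp

text \<open>Induction upwards and downwards from 0. The laws for \<open>int_scale\<close> below are
  checked against this recursion, without case distinctions on signs.\<close>

lemma int_scale_unique:
  assumes "f 0 = 0" and "\<And>k. f (k + 1) = f k + a"
  shows "f k = int_scale k a"
proof (induction k rule: int_induct[of _ 0])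
  case (step2 i)
  with assms(2)[of "i - 1"] show ?case by (simp add: int_scale_pred algebra_simps)
qed (simp_all add: assms int_scale_0 int_scale_Suc)

lemma additive_int_scale:
  assumes "additive f" shows "f (int_scale k a) = int_scale k (f a)"
  by (rule int_scale_unique)
     (simp_all add: int_scale_0 int_scale_Suc additive.zero[OF assms] additive.add[OF assms])

lemma int_scale_ring: "int_scale k x = of_int k * x" for x :: "'a::ring_1"
  by (rule int_scale_unique[symmetric]) (simp_all add: algebra_simps)

lemma int_scale_add_left: "int_scale (k + l) a = int_scale k a + int_scale l a"
proof -
  have "int_scale (k + (j + 1)) a = int_scale (k + j) a + a" for j
    using int_scale_Suc[of "k + j" a] by (simp add: add.assoc)
  then have "int_scale (k + l) a - int_scale k a = int_scale l a"
    by (intro int_scale_unique) simp_all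
  then show ?thesis by (simp add: algebra_simps)
qed

lemma int_scale_add_right: "int_scale k (a + b) = int_scale k a + int_scale k b"
  by (rule int_scale_unique[symmetric]) (simp_all add: int_scale_0 int_scale_Suc algebra_simps)

interpretation int_module: Modules.module int_scale
proof
  fix k l :: int and a b :: 'a
  show "int_scale k (int_scale l a) = int_scale (k * l) a"
    by (rule int_scale_unique[symmetric])
       (simp_all add: int_scale_0 int_scale_add_left distrib_right)
  show "int_scale 1 a = a"
    using int_scale_Suc[of 0 a] by (simp add: int_scale_0)
qed (rule int_scale_add_left int_scale_add_right)+

lemma additive_tensor_of_left: "additive (\<lambda>a. tensor_of a w)"
  by (simp add: additive_def tensor_of_add_left)

lemma additive_tensor_of_right: "additive (tensor_of a)"
  by (simp add: additive_def tensor_of_add_right)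

lemma tensor_of_int_scale: "tensor_of (int_scale k a) w = tensor_of a (of_int k * w)"
  using additive_int_scale[OF additive_tensor_of_left, of k a w]
    additive_int_scale[OF additive_tensor_of_right, of a k w]
  by (simp add: int_scale_ring)

section \<open>Finite generation: remainders, independent generators, integral coordinates\<close>

lemma group_closure_subset_span: "group_closure S \<subseteq> int_module.span S"
proof
  fix x assume "x \<in> group_closure S"
  then show "x \<in> int_module.span S"
    by induction (auto intro: int_module.span_base int_module.span_zero int_module.span_diff)
qed

text \<open>Write \<open>a\<close> in the generators and divide each coefficient by \<open>m\<close>
  with remainder: the quotients contribute an element of \<open>H\<close>, and the remainders leave
  only finitely many combinations.\<close>

lemma finitely_generated_remainders:
  fixes H :: "'g::ab_group_add set"
  assumes fg: "finitely_generated TYPE('g)"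
    and H: "int_module.subspace H" and m: "m > 0" and mult: "\<And>a. int_scale m a \<in> H"
  shows "\<exists>E. finite E \<and> (\<forall>a. \<exists>e\<in>E. a - e \<in> H)"
proof -
  obtain S :: "'g set" where S: "finite S" "group_closure S = UNIV"
    using fg unfolding finitely_generated_def by blast
  let ?E = "(\<lambda>r. \<Sum>s\<in>S. int_scale (r s) s) ` (S \<rightarrow>\<^sub>E {0..<m})"
  have "finite ?E" by (intro finite_imageI finite_PiE S) auto
  moreover have "\<exists>e\<in>?E. a - e \<in> H" for a
  proof -
    have "a \<in> int_module.span S" using S group_closure_subset_span by blast
    then obtain u where a: "a = (\<Sum>s\<in>S. int_scale (u s) s)"
      unfolding int_module.span_finite[OF S(1)] by blast
    let ?r = "restrict (\<lambda>s. u s mod m) S"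
    have "a - (\<Sum>s\<in>S. int_scale (?r s) s) = (\<Sum>s\<in>S. int_scale (u s div m) (int_scale m s))"
      unfolding a sum_subtractf[symmetric]
    proof (rule sum.cong[OF refl])
      fix s assume "s \<in> S"
      have "u s = u s div m * m + u s mod m" by simp
      then have "int_scale (u s) s = int_scale (u s div m * m) s + int_scale (u s mod m) s"
        by (metis int_scale_add_left)
      with \<open>s \<in> S\<close> show "int_scale (u s) s - int_scale (?r s) s
          = int_scale (u s div m) (int_scale m s)" by simp
    qed
    moreover have "\<dots> \<in> H"
      by (intro int_module.subspace_sum[OF H] int_module.subspace_scale[OF H] mult)
    moreover have "?r \<in> S \<rightarrow>\<^sub>E {0..<m}" using m by auto
    ultimately show ?thesis by (auto intro!: bexI[of _ ?r])
  qed
  ultimately show ?thesis by blast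
qed

text \<open>By maximality, each generator outside \<open>B\<close> occurs in a relation with
  \<open>B\<close>, so a nonzero multiple of it lies in the span; the product of these multipliers
  serves all generators at once.\<close>

lemma maximal_independent_multiple:
  fixes S :: "'g::ab_group_add set"
  assumes "finite S"
  shows "\<exists>B m. B \<subseteq> S \<and> \<not> int_module.dependent B \<and> (m::int) > 0 \<and>
    (\<forall>a\<in>int_module.span S. int_scale m a \<in> int_module.span B)"
proof -
  let ?I = "{B. B \<subseteq> S \<and> \<not> int_module.dependent B}"
  have "finite ?I" "?I \<noteq> {}" using assms int_module.independent_empty by auto
  then obtain B where B: "B \<subseteq> S" "\<not> int_module.dependent B"
    and max: "\<And>B'. B' \<in> ?I \<Longrightarrow> B \<subseteq> B' \<Longrightarrow> B = B'"
    using finite_has_maximal[of ?I] by (auto 0 3)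
  have fB: "finite B" using B(1) assms by (rule finite_subset)
  have "\<exists>k>0. int_scale k s \<in> int_module.span B" if s: "s \<in> S" for s
  proof (cases "s \<in> B")
    case True
    then show ?thesis by (intro exI[of _ 1]) (auto intro: int_module.span_base)
  next
    case False
    then have "int_module.dependent (insert s B)"
      using max[of "insert s B"] B(1) s by blast
    then obtain u where u: "\<exists>v\<in>insert s B. u v \<noteq> 0"
      and sum: "(\<Sum>v\<in>insert s B. int_scale (u v) v) = 0"
      using int_module.dependent_finite[of "insert s B"] fB by auto
    from sum have eq: "int_scale (u s) s = - (\<Sum>v\<in>B. int_scale (u v) v)"
      using fB False by (simp add: eq_neg_iff_add_eq_0)
    \<comment> \<open>Otherwise the relation would be a nontrivial one within the independent
      \<open>B\<close>.\<close>
    have "u s \<noteq> 0"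
    proof
      assume "u s = 0"
      with eq have "(\<Sum>v\<in>B. int_scale (u v) v) = 0" by simp
      then have "\<forall>v\<in>B. u v = 0"
        using int_module.independentD[OF B(2) fB order_refl] by blast
      with \<open>u s = 0\<close> u show False by auto
    qed
    moreover have mem: "int_scale (u s) s \<in> int_module.span B"
      unfolding eq by (intro int_module.span_neg int_module.span_sum int_module.span_scale
          int_module.span_base)
    \<comment> \<open>The sign makes the multiplier positive.\<close>
    then have "int_scale (sgn (u s) * u s) s \<in> int_module.span B"
      using int_module.span_scale[OF mem, of "sgn (u s)"] by simp
    ultimately show ?thesis
      by (intro exI[of _ "sgn (u s) * u s"]) (auto simp: sgn_if)
  qed
  then obtain k where k: "\<And>s. s \<in> S \<Longrightarrow> k s > 0 \<and> int_scale (k s) s \<in> int_module.span B"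
    by metis
  define m where "m = (\<Prod>s\<in>S. k s)"
  have "m > 0" unfolding m_def using k by (intro prod_pos) auto
  moreover have ms: "int_scale m s \<in> int_module.span B" if "s \<in> S" for s
  proof -
    have "m = (\<Prod>s\<in>S - {s}. k s) * k s"
      unfolding m_def using assms that by (simp add: prod.remove mult.commute)
    then show ?thesis
      using int_module.span_scale[of "int_scale (k s) s" B "\<Prod>s\<in>S - {s}. k s"] k[OF that]
      by simp
  qed
  have "int_scale m a \<in> int_module.span B" if "a \<in> int_module.span S" for a
    using that
  proof (induction rule: int_module.span_induct_alt)
    case (step c x y)
    have "int_scale m (int_scale c x + y) = int_scale c (int_scale m x) + int_scale m y"
      by (simp add: int_scale_add_right mult.commute)
    with step ms show ?case
      by (simp only: int_module.span_add int_module.span_scale)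
  qed (simp add: int_module.span_zero)
  ultimately show ?thesis using B by blast
qed

text \<open>The \<open>c i\<close> are the coefficients of \<open>m a\<close> rather than of
  \<open>a\<close>, which keeps them integral; hence the factor \<open>m\<close> in
  \<open>c_b\<close>. They vanish on torsion and so need not separate elements, but by
  \<open>finite_ball\<close> only finitely many elements share the same coordinates.\<close>

locale integral_coordinates =
  fixes d :: nat and m :: int and b :: "nat \<Rightarrow> 'g::ab_group_add" and c :: "nat \<Rightarrow> 'g \<Rightarrow> int"
  assumes m_pos: "m > 0"
    and additive_c: "\<And>i. additive (c i)"
    and expand: "\<And>a. int_scale m a = (\<Sum>i<d. int_scale (c i a) (b i))"
    and c_b: "\<And>i j. i < d \<Longrightarrow> j < d \<Longrightarrow> c i (b j) = (if i = j then m else 0)"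
    and finite_ball: "\<And>K. finite {a. \<forall>i<d. \<bar>c i a\<bar> \<le> K}"

lemma finitely_generated_integral_coordinates:
  assumes fg: "finitely_generated TYPE('g::ab_group_add)"
  shows "\<exists>d m (b :: nat \<Rightarrow> 'g) c. integral_coordinates d m b c"
proof -
  obtain S :: "'g set" where S: "finite S" "group_closure S = UNIV"
    using fg unfolding finitely_generated_def by blast
  have span_S: "int_module.span S = UNIV" using S group_closure_subset_span by blast
  obtain B m where B: "B \<subseteq> S" and ind: "\<not> int_module.dependent B" and m: "(m::int) > 0"
    and mult: "\<And>a. int_scale m a \<in> int_module.span B"
    using maximal_independent_multiple[OF S(1)] unfolding span_S by auto
  have fB: "finite B" using B S(1) by (rule finite_subset)
  then obtain bs where bs: "set bs = B" "distinct bs" using finite_distinct_list by blast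
  define d where "d = length bs"
  define c where "c i a = int_module.representation B (int_scale m a) (bs ! i)" for i a
  have bij: "bij_betw ((!) bs) {..<d} B"
    using bij_betw_nth[OF bs(2)] bs(1) by (simp add: d_def)
  have c_add: "c i (a + a') = c i a + c i a'" for i a a'
    by (simp add: c_def int_scale_add_right int_module.representation_add[OF ind mult mult])
  have expand: "int_scale m a = (\<Sum>i<d. int_scale (c i a) (bs ! i))" for a
    unfolding c_def
    by (subst sum.reindex_bij_betw[OF bij]) (simp add: int_module.sum_representation_eq[OF ind mult fB])
  have "c i (bs ! j) = (if i = j then m else 0)" if "i < d" "j < d" for i j
  proof -
    have "bs ! j \<in> B" using that bs by (auto simp: d_def)
    then show ?thesis
      using that bs(2) by (auto simp: c_def int_module.representation_scale[OF ind int_module.span_base]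
          int_module.representation_basis[OF ind] d_def nth_eq_iff_index_eq)
  qed
  moreover have "finite {a. \<forall>i<d. \<bar>c i a\<bar> \<le> K}" for K
  proof -
    obtain E where E: "finite E" "\<And>a. \<exists>e\<in>E. a - e \<in> int_module.span B"
      using finitely_generated_remainders[OF fg int_module.subspace_span m mult] by blast
    from E(2) obtain e where e: "\<And>a. e a \<in> E" "\<And>a. a - e a \<in> int_module.span B" by metis
    \<comment> \<open>A remainder modulo the span of \<open>B\<close> and the coordinates together
      determine an element, and a ball yields only finitely many such pairs.\<close>
    let ?h = "\<lambda>a. (e a, restrict (\<lambda>i. c i a) {..<d})"
    have inj: "inj ?h"
    proof
      fix x y assume "?h x = ?h y"
      then have exy: "e x = e y" and "restrict (\<lambda>i. c i x) {..<d} = restrict (\<lambda>i. c i y) {..<d}"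
        by auto
      then have "c i x = c i y" if "i < d" for i
        using that by (metis lessThan_iff restrict_apply')
      then have m0: "int_scale m x = int_scale m y"
        unfolding expand by simp
      have xy: "x - y \<in> int_module.span B"
        using int_module.span_diff[OF e(2)[of x] e(2)[of y]] exy by simp
      have "int_scale m (x - y) = 0"
        using m0 by (simp add: int_module.scale_right_diff_distrib)
      \<comment> \<open>The span of the independent \<open>B\<close> has no torsion:
        \<open>m\<close> times each coefficient is 0, hence so is the coefficient.\<close>
      then have "int_module.representation B (x - y) v = 0" for v
        using int_module.representation_scale[OF ind xy, of m, THEN fun_cong, of v] m
        by (simp add: int_module.representation_zero)
      then show "x = y"
        using int_module.sum_representation_eq[OF ind xy fB order_refl] by simp
    qed
    have "?h ` {a. \<forall>i<d. \<bar>c i a\<bar> \<le> K} \<subseteq> E \<times> ({..<d} \<rightarrow>\<^sub>E {-K..K})"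
      using e(1) by (auto simp: image_subset_iff restrict_PiE_iff abs_le_iff simp del: restrict_apply)
    moreover have "finite (E \<times> ({..<d} \<rightarrow>\<^sub>E {-K..K}))"
      using E(1) by (intro finite_cartesian_product finite_PiE) auto
    ultimately show ?thesis
      by (rule finite_imageD[OF finite_subset inj_on_subset[OF inj subset_UNIV]])
  qed
  ultimately have "integral_coordinates d m ((!) bs) c"
    using m expand c_add by (simp add: integral_coordinates_def additive_def)
  then show ?thesis by blast
qed


section \<open>Biadditive maps on tensor products\<close>

text \<open>The extension of \<open>h\<close> to a homomorphism on the free abelian group.\<close>

definition frag_eval :: "('x \<Rightarrow> 'b::ab_group_add) \<Rightarrow> ('x \<Rightarrow>\<^sub>0 int) \<Rightarrow> 'b" where
  "frag_eval h x = (\<Sum>p\<in>Poly_Mapping.keys x. int_scale (Poly_Mapping.lookup x p) (h p))"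

lemma frag_eval_superset:
  assumes "finite A" "Poly_Mapping.keys x \<subseteq> A"
  shows "frag_eval h x = (\<Sum>p\<in>A. int_scale (Poly_Mapping.lookup x p) (h p))"
  unfolding frag_eval_def using assms
  by (intro sum.mono_neutral_left) (auto simp: in_keys_iff)

lemma frag_eval_diff: "frag_eval h (x - y) = frag_eval h x - frag_eval h y"
proof -
  let ?A = "Poly_Mapping.keys x \<union> Poly_Mapping.keys y"
  have "Poly_Mapping.keys (x - y) \<subseteq> ?A" by (rule keys_diff)
  then show ?thesis
    by (subst (1 2 3) frag_eval_superset[of ?A])
       (auto simp: lookup_minus int_module.scale_left_diff_distrib sum_subtractf)
qed

lemma frag_eval_frag_of: "frag_eval h (frag_of p) = h p"
  by (simp add: frag_eval_def)

text \<open>For biadditive \<open>h\<close> this is the homomorphism of the universal property;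
  \<open>tensor_lift_abs\<close> then gives independence of the representative.\<close>

definition tensor_lift ::
  "('a::ab_group_add \<Rightarrow> 'b::ab_group_add \<Rightarrow> 'c::ab_group_add) \<Rightarrow> ('a, 'b) tensor \<Rightarrow> 'c" where
  "tensor_lift h t = frag_eval (\<lambda>(a, b). h a b) (rep_tensor t)"

context
  fixes h :: "'a::ab_group_add \<Rightarrow> 'b::ab_group_add \<Rightarrow> 'c::ab_group_add"
  assumes left: "\<And>b. additive (\<lambda>a. h a b)" and right: "\<And>a. additive (h a)"
begin

text \<open>Biadditivity makes the evaluation vanish on the relators, hence on the subgroup that
  they generate.\<close>

lemma tensor_lift_abs: "tensor_lift h (abs_tensor x) = frag_eval (\<lambda>(a, b). h a b) x"
proof -
  let ?e = "frag_eval (\<lambda>(a, b). h a b)"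
  have "?e z = 0" if "z \<in> group_closure tensor_relators" for z
    using that
  proof induction
    \<comment> \<open>The base case includes \<open>s = 0\<close>, whose value is obtained from
      \<open>frag_eval_diff\<close> applied to \<open>s\<close> and \<open>s\<close>.\<close>
    case (base s)
    then show ?case
      using additive.add[OF left] additive.add[OF right] frag_eval_diff[of "\<lambda>(a, b). h a b" s s]
      by (auto simp: tensor_relators_def frag_eval_diff frag_eval_frag_of)
  next
    case (diff s t)
    then show ?case by (simp add: frag_eval_diff)
  qed
  moreover have "tensor_rel (rep_tensor (abs_tensor x)) x"
    by (metis Quotient3_tensor Quotient3_rep_abs tensor.abs_eq_iff Quotient3_abs_rep)
  ultimately have "?e (rep_tensor (abs_tensor x) - x) = 0"
    by (simp add: tensor_rel_def)
  then show ?thesis by (simp add: tensor_lift_def frag_eval_diff)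
qed

lemma tensor_lift_tensor_of: "tensor_lift h (tensor_of a b) = h a b"
  by (simp add: tensor_of.abs_eq tensor_lift_abs frag_eval_frag_of)

lemma tensor_lift_diff: "tensor_lift h (x - y) = tensor_lift h x - tensor_lift h y"
proof -
  obtain p q where "x = abs_tensor p" "y = abs_tensor q"
    by (metis Quotient3_abs_rep Quotient3_tensor)
  then show ?thesis by (simp add: minus_tensor.abs_eq tensor_lift_abs frag_eval_diff)
qed

lemma additive_tensor_lift: "additive (tensor_lift h)"
proof
  fix x y
  have "tensor_lift h (- y) = - tensor_lift h y" for y
    using tensor_lift_diff[of 0 y] tensor_lift_diff[of 0 0] by simp
  then show "tensor_lift h (x + y) = tensor_lift h x + tensor_lift h y"
    using tensor_lift_diff[of x "- y"] by simp
qed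

end

section \<open>The complex matrix of an endomorphism\<close>

context integral_coordinates
begin

lemma c_int_scale: "c i (int_scale k a) = k * c i a"
  by (simp add: additive_int_scale[OF additive_c] int_scale_ring)

lemma m_nonzero: "(of_int m :: 'r::field_char_0) \<noteq> 0"
  using m_pos by simp

definition coords :: "'g \<Rightarrow> complex vec" where
  "coords a = vec d (\<lambda>i. of_int (c i a))"

text \<open>Column \<open>j\<close> holds the rational coordinates of \<open>F (b j)\<close>: since
  \<open>c i (b i) = m\<close>, the functional \<open>c i\<close> is \<open>m\<close> times the true
  coordinate.\<close>

definition coord_mat :: "('g \<Rightarrow> 'g) \<Rightarrow> complex mat" where
  "coord_mat F = mat d d (\<lambda>(i, j). of_int (c i (F (b j))) / of_int m)"

lemma coord_mat_carrier [simp]: "coord_mat F \<in> carrier_mat d d"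
  by (simp add: coord_mat_def)

lemma coords_carrier [simp]: "coords a \<in> carrier_vec d"
  by (simp add: coords_def)

text \<open>The complex-linear extension of \<open>c i\<close>, so again \<open>m\<close> times a
  true coordinate.\<close>

definition tensor_coord :: "nat \<Rightarrow> ('g, complex) tensor \<Rightarrow> complex" where
  "tensor_coord i = tensor_lift (\<lambda>a w. of_int (c i a) * w)"

lemma additive_tensor_coord: "additive (tensor_coord i)"
  unfolding tensor_coord_def
  by (rule additive_tensor_lift) (simp_all add: additive_def additive.add[OF additive_c] algebra_simps)

lemma tensor_coord_tensor_of: "tensor_coord i (tensor_of a w) = of_int (c i a) * w"
  unfolding tensor_coord_def
  by (rule tensor_lift_tensor_of) (simp_all add: additive_def additive.add[OF additive_c] algebra_simps)

lemma tensor_coord_scale: "tensor_coord i (scale_complexification z v) = z * tensor_coord i v"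
  by (induction v rule: tensor_induct)
     (simp_all add: additive.zero[OF additive_scale_complexification] additive.zero[OF additive_tensor_coord]
       additive.diff[OF additive_scale_complexification] additive.diff[OF additive_tensor_coord]
       tensor_coord_tensor_of algebra_simps)

text \<open>Over the complex numbers \<open>m\<close> is invertible: moving it across the tensor
  sign turns \<open>a\<close> into \<open>int_scale m a\<close>, to which \<open>expand\<close>
  applies.\<close>

lemma tensor_expand: "v = (\<Sum>i<d. tensor_of (b i) (tensor_coord i v / of_int m))"
proof (induction v rule: tensor_induct)
  case zero
  show ?case
    by (simp add: additive.zero[OF additive_tensor_coord] additive.zero[OF additive_tensor_of_right])
next
  case (tensor_of a w)
  have "tensor_of a w = tensor_of (int_scale m a) (w / of_int m)"
    using m_nonzero by (simp add: tensor_of_int_scale)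
  also have "\<dots> = (\<Sum>i<d. tensor_of (b i) (of_int (c i a) * (w / of_int m)))"
    unfolding expand by (simp add: additive.sum[OF additive_tensor_of_left] tensor_of_int_scale)
  finally show ?case unfolding tensor_coord_tensor_of times_divide_eq_right .
next
  case (diff x y)
  have "(\<Sum>i<d. tensor_of (b i) (tensor_coord i (x - y) / of_int m)) =
      (\<Sum>i<d. tensor_of (b i) (tensor_coord i x / of_int m)) - (\<Sum>i<d. tensor_of (b i) (tensor_coord i y / of_int m))"
    by (simp add: additive.diff[OF additive_tensor_coord] diff_divide_distrib
        additive.diff[OF additive_tensor_of_right] sum_subtractf)
  then show ?case by (simp only: diff[symmetric])
qed

text \<open>Coordinates that may miss torsion in the group do separate the elements of its
  complexification.\<close>

lemma tensor_coord_eqI: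
  assumes "\<And>i. i < d \<Longrightarrow> tensor_coord i v = tensor_coord i w"
  shows "v = w"
proof -
  have "(\<Sum>i<d. tensor_of (b i) (tensor_coord i v / of_int m))
      = (\<Sum>i<d. tensor_of (b i) (tensor_coord i w / of_int m))"
    using assms by simp
  then show ?thesis by (simp only: tensor_expand[symmetric])
qed

section \<open>The matrix action of an endomorphism, its eigenvalues and eigenfunctionals\<close>

context
  fixes F :: "'g \<Rightarrow> 'g"
  assumes F: "additive F"
begin

text \<open>Expand \<open>F (int_scale m a)\<close> in the basis and cancel \<open>m\<close>, which
  is possible because the coordinates are numbers.\<close>

lemma c_image: "of_int (c i (F a)) = (\<Sum>j<d. of_int (c i (F (b j))) / of_int m * of_int (c j a) :: complex)"
proof -
  have "m * c i (F a) = c i (F (int_scale m a))"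
    by (simp add: additive_int_scale[OF F] c_int_scale)
  also have "\<dots> = (\<Sum>j<d. c j a * c i (F (b j)))"
    unfolding expand
    by (simp add: additive.sum[OF F] additive.sum[OF additive_c] additive_int_scale[OF F] c_int_scale)
  finally have "of_int (m * c i (F a)) = (of_int (\<Sum>j<d. c j a * c i (F (b j))) :: complex)"
    by (rule arg_cong)
  then show ?thesis
    using m_nonzero[where ?'r = complex]
    by (simp add: field_simps sum_distrib_left flip: sum_divide_distrib)
qed

lemma coords_image: "coords (F a) = coord_mat F *\<^sub>v coords a"
  by (rule eq_vecI)
     (auto simp: coords_def coord_mat_def scalar_prod_def c_image[of _ a] atLeast0LessThan)

lemma tensor_coord_map:
  assumes "i < d"
  shows "tensor_coord i (complexification_map F v)
    = (\<Sum>j<d. coord_mat F $$ (i, j) * tensor_coord j v)"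
proof (induction v rule: tensor_induct)
  case zero
  show ?case
    by (simp add: additive.zero[OF additive_tensor_coord]
        additive.zero[OF additive_tensor_map[OF F additive_id], unfolded id_def])
next
  case (tensor_of a w)
  then show ?case using assms
    by (simp add: tensor_map_tensor_of[OF F additive_id, unfolded id_def] tensor_coord_tensor_of
        c_image[of _ a] coord_mat_def sum_distrib_right mult.assoc)
next
  case (diff x y)
  then show ?case
    by (simp add: additive.diff[OF additive_tensor_coord] 
        additive.diff[OF additive_tensor_map[OF F additive_id], unfolded id_def]
        right_diff_distrib sum_subtractf)
qed

text \<open>The coordinates identify the complexification with complex vectors and its map with the
  matrix, so eigenvectors can be transported both ways.\<close>

lemma is_eigenvalue_iff_coord_mat:
  "is_eigenvalue scale_complexification (complexification_map F) l \<longleftrightarrow> eigenvalue (coord_mat F) l"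
proof
  assume "is_eigenvalue scale_complexification (complexification_map F) l"
  then obtain v where v: "v \<noteq> 0" "complexification_map F v = scale_complexification l v"
    unfolding is_eigenvalue_def by blast
  let ?x = "vec d (\<lambda>i. tensor_coord i v)"
  have "coord_mat F *\<^sub>v ?x = l \<cdot>\<^sub>v ?x"
  proof (rule eq_vecI)
    fix i assume "i < dim_vec (l \<cdot>\<^sub>v ?x)"
    then have i: "i < d" by simp
    then have "(coord_mat F *\<^sub>v ?x) $ i = (\<Sum>j<d. coord_mat F $$ (i, j) * tensor_coord j v)"
      by (simp add: coord_mat_def scalar_prod_def atLeast0LessThan)
    also have "\<dots> = l * tensor_coord i v"
      using tensor_coord_map[OF i, of v] by (simp add: v(2) tensor_coord_scale)
    finally show "(coord_mat F *\<^sub>v ?x) $ i = (l \<cdot>\<^sub>v ?x) $ i" using i by simp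
  qed (simp add: coord_mat_def)
  moreover have "?x \<noteq> 0\<^sub>v d"
  proof
    assume x0: "?x = 0\<^sub>v d"
    have "tensor_coord i v = tensor_coord i 0" if "i < d" for i
      using arg_cong[OF x0, of "\<lambda>u. u $ i"] that by (simp add: additive.zero[OF additive_tensor_coord])
    with v(1) show False by (metis tensor_coord_eqI)
  qed
  ultimately show "eigenvalue (coord_mat F) l"
    unfolding eigenvalue_def eigenvector_def
    by (intro exI[of _ ?x]) (simp add: coord_mat_def)
next
  assume "eigenvalue (coord_mat F) l"
  then obtain x where x: "x \<in> carrier_vec d" "x \<noteq> 0\<^sub>v d" "coord_mat F *\<^sub>v x = l \<cdot>\<^sub>v x"
    unfolding eigenvalue_def eigenvector_def by (auto simp: coord_mat_def)
  \<comment> \<open>The entries of \<open>x\<close> serve as coefficients; the coordinates then come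
    out as \<open>m\<close> times \<open>x\<close>, which is still an eigenvector.\<close>
  let ?v = "\<Sum>j<d. tensor_of (b j) (x $ j)"
  have coord: "tensor_coord i ?v = of_int m * x $ i" if i: "i < d" for i
  proof -
    have "tensor_coord i ?v = (\<Sum>j<d. of_int (c i (b j)) * x $ j)"
      by (simp add: additive.sum[OF additive_tensor_coord] tensor_coord_tensor_of)
    also have "\<dots> = (\<Sum>j<d. if i = j then of_int m * x $ j else 0)"
      using i by (intro sum.cong) (auto simp: c_b)
    finally show ?thesis using i by simp
  qed
  have "complexification_map F ?v = scale_complexification l ?v"
  proof (rule tensor_coord_eqI)
    fix i assume i: "i < d"
    have "tensor_coord i (complexification_map F ?v) = (\<Sum>j<d. coord_mat F $$ (i, j) * (of_int m * x $ j))"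
      unfolding tensor_coord_map[OF i] by (simp add: coord)
    also have "\<dots> = of_int m * (coord_mat F *\<^sub>v x) $ i"
      using i x(1) by (simp add: coord_mat_def scalar_prod_def atLeast0LessThan sum_distrib_left mult_ac)
    also have "\<dots> = tensor_coord i (scale_complexification l ?v)"
      using i x(1) by (simp add: x(3) tensor_coord_scale coord)
    finally show "tensor_coord i (complexification_map F ?v) = tensor_coord i (scale_complexification l ?v)" .
  qed
  moreover have "?v \<noteq> 0"
  proof
    assume v0: "?v = 0"
    have "x $ i = 0" if "i < d" for i
      using coord[OF that] m_pos unfolding v0 by (simp add: additive.zero[OF additive_tensor_coord])
    then have "x = 0\<^sub>v d" using x(1) by (intro eq_vecI) auto
    with x(2) show False by simp
  qed
  ultimately show "is_eigenvalue scale_complexification (complexification_map F) l"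
    unfolding is_eigenvalue_def by blast
qed

text \<open>A matrix and its transpose have the same characteristic polynomial; pairing an
  eigenvector of the transpose with the coordinates gives the functional.\<close>

lemma eigenfunctional_exists:
  assumes "eigenvalue (coord_mat F) l"
  shows "\<exists>\<phi> :: 'g \<Rightarrow> complex. additive \<phi> \<and> (\<forall>a. \<phi> (F a) = l * \<phi> a) \<and> (\<exists>a. \<phi> a \<noteq> 0)"
proof -
  let ?A = "coord_mat F"
  have "eigenvalue (transpose_mat ?A) l"
    using assms by (subst eigenvalue_root_char_poly[of _ d])
      (simp_all add: eigenvalue_root_char_poly[of _ d] char_poly_transpose_mat[of _ d])
  then obtain y where y: "y \<in> carrier_vec d" "y \<noteq> 0\<^sub>v d" "transpose_mat ?A *\<^sub>v y = l \<cdot>\<^sub>v y"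
    unfolding eigenvalue_def eigenvector_def by (auto simp: coord_mat_def)
  let ?\<phi> = "\<lambda>a. y \<bullet> coords a"
  have phi: "?\<phi> a = (\<Sum>i<d. y $ i * of_int (c i a))" for a
    by (simp add: scalar_prod_def coords_def atLeast0LessThan)
  have "additive ?\<phi>"
    by (simp add: additive_def phi additive.add[OF additive_c] distrib_left sum.distrib)
  moreover have "?\<phi> (F a) = l * ?\<phi> a" for a
  proof -
    have "y \<bullet> (?A *\<^sub>v coords a) = (transpose_mat ?A *\<^sub>v y) \<bullet> coords a"
      using y(1) by (intro transpose_vec_mult_scalar[of _ d d, symmetric]) auto
    then show ?thesis
      using y(1) by (simp add: coords_image y(3))
  qed
  moreover have "\<exists>a. ?\<phi> a \<noteq> 0"
  proof (rule ccontr)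
    assume "\<not> ?thesis"
    then have z: "?\<phi> (b j) = 0" for j by blast
    \<comment> \<open>At \<open>b j\<close> the functional takes the value \<open>m\<close> times
      \<open>y $ j\<close>.\<close>
    have "y $ j = 0" if j: "j < d" for j
    proof -
      have "?\<phi> (b j) = (\<Sum>i<d. if j = i then y $ i * of_int m else 0)"
        unfolding phi using j by (intro sum.cong) (auto simp: c_b)
      with z j m_pos show ?thesis by simp
    qed
    then have "y = 0\<^sub>v d" using y(1) by (intro eq_vecI) auto
    with y(2) show False by simp
  qed
  ultimately show ?thesis by blast
qed

end

end

section \<open>Spanning sets force expansion\<close>

lemma string_value_Nil: "string_value G [] = 0"
  by (simp add: string_value_def)

lemma string_value_Cons:
  assumes "additive G"
  shows "string_value G (x # s) = x + G (string_value G s)"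
  by (simp add: string_value_def sum.lessThan_Suc_shift additive.sum[OF assms] del: sum.lessThan_Suc)

text \<open>
  Addition with carry: at each digit, twice the digit plus the carry is again a digit plus a carry,
  by the condition on sums of five elements padded with zeros.
\<close>
lemma spanning_set_double_carry:
  assumes S: "spanning_set G S" and G: "additive G"
    and "s \<in> lists S" "e \<in> S"
  shows "\<exists>u\<in>lists S. length u = Suc (length s) \<and>
    string_value G u = string_value G s + string_value G s + e"
  using assms(3,4)
proof (induction s arbitrary: e rule: lists.induct)
  case Nil
  then show ?case
    by (intro bexI[of _ "[e]"])
       (simp_all add: string_value_Nil string_value_Cons[OF G] additive.zero[OF G])
next
  case (Cons x t)
  have "0 \<in> S" using S by (simp add: spanning_set_def)
  then obtain y z where yz: "y \<in> S" "z \<in> S" "x + x + e + 0 + 0 = y + G z"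
    using S Cons.hyps Cons.prems unfolding spanning_set_def by metis
  obtain u where u: "u \<in> lists S" "length u = Suc (length t)"
    "string_value G u = string_value G t + string_value G t + z"
    using Cons.IH[OF yz(2)] by blast
  have "string_value G (y # u) = (y + G z) + (G (string_value G t) + G (string_value G t))"
    by (simp add: string_value_Cons[OF G] u(3) additive.add[OF G] algebra_simps)
  also have "\<dots> = string_value G (x # t) + string_value G (x # t) + e"
    unfolding yz(3)[symmetric] by (simp add: string_value_Cons[OF G] algebra_simps)
  finally show ?case using u yz(1) by (intro bexI[of _ "y # u"]) auto
qed

text \<open>Iterated doubling with initial carry 0: each round costs one digit.\<close>

lemma spanning_set_power_of_two:
  assumes S: "spanning_set G S" and G: "additive G" and "s \<in> lists S"
  shows "\<exists>u\<in>lists S. length u = length s + k \<and>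
    string_value G u = int_scale (2 ^ k) (string_value G s)"
proof (induction k)
  case 0
  then show ?case using assms(3) by auto
next
  case (Suc k)
  then obtain u where u: "u \<in> lists S" "length u = length s + k"
    "string_value G u = int_scale (2 ^ k) (string_value G s)" by blast
  have "0 \<in> S" using S by (simp add: spanning_set_def)
  then obtain w where w: "w \<in> lists S" "length w = Suc (length u)"
    "string_value G w = string_value G u + string_value G u + 0"
    using spanning_set_double_carry[OF S G u(1)] by blast
  have "string_value G w = int_scale (2 ^ k + 2 ^ k) (string_value G s)"
    unfolding int_scale_add_left w(3) u(3) by simp
  then show ?case using w(1,2) u(2) by (intro bexI[of _ w]) simp_all
qed

text \<open>Under \<open>\<phi>\<close> the digit at place \<open>i\<close> is weighted by
  \<open>l ^ i\<close>, of modulus at most 1, so every digit contributes at most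
  \<open>K\<close>.\<close>

lemma norm_eigenfunctional_string_value:
  fixes \<phi> :: "'g::ab_group_add \<Rightarrow> complex"
  assumes G: "additive G" and \<phi>: "additive \<phi>" and ev: "\<And>a. \<phi> (G a) = l * \<phi> a" and l: "cmod l \<le> 1"
    and K: "\<And>x. x \<in> S \<Longrightarrow> cmod (\<phi> x) \<le> K" and s: "s \<in> lists S"
  shows "cmod (\<phi> (string_value G s)) \<le> K * length s"
  using s
proof (induction s rule: lists.induct)
  case Nil
  then show ?case by (simp add: string_value_Nil additive.zero[OF \<phi>])
next
  case (Cons x t)
  have "\<phi> (string_value G (x # t)) = \<phi> x + l * \<phi> (string_value G t)"
    by (simp add: string_value_Cons[OF G] additive.add[OF \<phi>] ev)
  then have "cmod (\<phi> (string_value G (x # t))) \<le> cmod (\<phi> x) + cmod l * cmod (\<phi> (string_value G t))"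
    by (metis norm_mult norm_triangle_ineq)
  also have "\<dots> \<le> K + 1 * (K * length t)"
    using K[OF Cons.hyps(1)] Cons.IH l by (intro add_mono mult_mono) auto
  finally show ?case by (simp add: algebra_simps)
qed

text \<open>The values on \<open>int_scale (2 ^ k) a\<close> grow like \<open>2 ^ k\<close>, whereas
  the strings representing these multiples allow only linear growth in \<open>k\<close>.\<close>

lemma spanning_set_eigenfunctional_eq_0:
  fixes \<phi> :: "'g::ab_group_add \<Rightarrow> complex"
  assumes S: "spanning_set G S" and G: "additive G"
    and \<phi>: "additive \<phi>" and ev: "\<And>a. \<phi> (G a) = l * \<phi> a" and l: "cmod l \<le> 1"
  shows "\<phi> a = 0"
proof (rule ccontr)
  assume nz: "\<phi> a \<noteq> 0"
  obtain s where s: "s \<in> lists S" "a = string_value G s"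
    using S[unfolded spanning_set_def, THEN conjunct2, THEN conjunct1] by metis
  define K where "K = (\<Sum>x\<in>S. cmod (\<phi> x))"
  have K: "cmod (\<phi> x) \<le> K" if "x \<in> S" for x
    unfolding K_def using that S[unfolded spanning_set_def, THEN conjunct1]
    by (intro member_le_sum) simp_all
  have "2 ^ k * cmod (\<phi> a) \<le> K * real (length s + k)" for k
  proof -
    obtain u where u: "u \<in> lists S" "length u = length s + k" "string_value G u = int_scale (2 ^ k) a"
      using spanning_set_power_of_two[OF S G s(1), of k] unfolding s(2)[symmetric] by blast
    have "cmod (\<phi> (string_value G u)) \<le> K * length u"
      by (rule norm_eigenfunctional_string_value[OF G \<phi> ev l K u(1)])
    then show ?thesis
      unfolding u(2,3) additive_int_scale[OF \<phi>] int_scale_ring by (simp add: norm_mult norm_power)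
  qed
  \<comment> \<open>Dividing by \<open>2 ^ k\<close> gives a bound that tends to 0.\<close>
  then have bound: "cmod (\<phi> a) \<le> K * (length s * (1 / 2) ^ k + k * (1 / 2) ^ k)" for k
    by (simp add: power_one_over divide_simps) (simp add: algebra_simps)
  have "(\<lambda>k. K * (length s * (1 / 2) ^ k + k * (1 / 2) ^ k)) \<longlonglongrightarrow> 0"
    by (intro tendsto_mult_right_zero tendsto_add_zero LIMSEQ_power_zero powser_times_n_limit_0) simp_all
  then have "cmod (\<phi> a) \<le> 0"
    by (rule LIMSEQ_le_const) (use bound in blast)
  with nz show False by simp
qed

section \<open>Expansion yields spanning sets\<close>

locale expanding_length =
  fixes G :: "'g::ab_group_add \<Rightarrow> 'g" and N :: "'g \<Rightarrow> real"
  assumes additive_G: "additive G"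
    and N_add: "\<And>a b. N (a + b) \<le> N a + N b"
    and N_minus: "\<And>a. N (- a) = N a"
    and finite_N: "\<And>R. finite {a. N a \<le> R}"
    and N_G: "\<And>a. 6 * N a \<le> N (G a)"
begin

text \<open>Subadditivity gives \<open>0 \<le> N 0\<close>, and expansion at 0 gives
  \<open>6 * N 0 \<le> N 0\<close>.\<close>

lemma N_0: "N 0 = 0"
  using N_add[of 0 0] N_G[of 0] by (simp add: additive.zero[OF additive_G])

lemma spanning_set_ball:
  assumes R: "\<And>a. \<exists>e. N e \<le> R \<and> a - e \<in> range G" and "R \<ge> 0"
  shows "spanning_set G {a. N a \<le> R}"
proof -
  let ?S = "{a. N a \<le> R}"
  have division: "\<exists>e q. e \<in> ?S \<and> a = e + G q \<and> 6 * N q \<le> N a + R" for a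
  proof -
    obtain e q where e: "N e \<le> R" "a - e = G q" using R by blast
    have "6 * N q \<le> N (a + - e)" using N_G[of q] by (simp flip: e(2))
    also have "\<dots> \<le> N a + R" using N_add[of a "- e"] e(1) by (simp add: N_minus)
    finally show ?thesis using e by (metis add.commute diff_add_cancel mem_Collect_eq)
  qed
  have "\<exists>s\<in>lists ?S. a = string_value G s" for a
  \<comment> \<open>Lengths are real, so the induction runs over the number of elements shorter than
    \<open>a\<close>, which is finite because balls are.\<close>
  proof (induction "card {x. N x < N a}" arbitrary: a rule: less_induct)
    case less
    show ?case
    proof (cases "N a \<le> R")
      case True
      then show ?thesis
        by (intro bexI[of _ "[a]"])
           (simp_all add: string_value_Nil string_value_Cons[OF additive_G] additive.zero[OF additive_G])
    next
      case False
      obtain e q where e: "e \<in> ?S" "a = e + G q" "6 * N q \<le> N a + R" using division by blast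
      \<comment> \<open>Outside the ball, \<open>6 * N q \<le> N a + R < 2 * N a\<close>.\<close>
      have "N q < N a" using e(3) False \<open>R \<ge> 0\<close> by linarith
      moreover from this have "{x. N x < N q} \<subset> {x. N x < N a}"
        by (auto intro: less_trans)
      moreover have "finite {x. N x < N a}"
        by (rule finite_subset[OF _ finite_N[of "N a"]]) auto
      ultimately obtain s where s: "s \<in> lists ?S" "q = string_value G s"
        using less[of q] by (auto intro: psubset_card_mono)
      with e show ?thesis
        by (intro bexI[of _ "e # s"]) (simp_all add: string_value_Cons[OF additive_G])
    qed
  qed
  moreover have "\<exists>x\<in>?S. \<exists>y\<in>?S. a1 + a2 + a3 + a4 + a5 = x + G y"
    if "a1 \<in> ?S" "a2 \<in> ?S" "a3 \<in> ?S" "a4 \<in> ?S" "a5 \<in> ?S" for a1 a2 a3 a4 a5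
  proof -
    have "N (a1 + a2 + a3 + a4 + a5) \<le> 5 * R"
      using that N_add[of "a1 + a2 + a3 + a4" a5] N_add[of "a1 + a2 + a3" a4]
        N_add[of "a1 + a2" a3] N_add[of a1 a2] by simp
    moreover obtain e q where "e \<in> ?S" "a1 + a2 + a3 + a4 + a5 = e + G q"
      "6 * N q \<le> N (a1 + a2 + a3 + a4 + a5) + R" using division by blast
    ultimately show ?thesis by (intro bexI[of _ e] bexI[of _ q]) auto
  qed
  moreover have "a1 + a2 + a3 \<in> G ` ?S"
    if in_ball: "a1 \<in> ?S" "a2 \<in> ?S" "a3 \<in> ?S" and "a1 + a2 + a3 \<in> range G" for a1 a2 a3
  proof -
    from \<open>a1 + a2 + a3 \<in> range G\<close> obtain q where q: "a1 + a2 + a3 = G q" by blast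
    \<comment> \<open>The sum itself is \<open>G q\<close>, so no remainder has to be
      subtracted.\<close>
    have "6 * N q \<le> 3 * R"
      using in_ball N_G[of q] N_add[of "a1 + a2" a3] N_add[of a1 a2] by (simp flip: q)
    then have "q \<in> ?S" using \<open>R \<ge> 0\<close> by simp
    with q show ?thesis by blast
  qed
  ultimately show ?thesis
    unfolding spanning_set_def using finite_N \<open>R \<ge> 0\<close> by (simp add: N_0 N_minus)
qed

end

section \<open>Matrices whose eigenvalues lie outside the unit disc\<close>

lemma smult_mat_mult_vec:
  fixes k :: "'a::comm_semiring_0"
  assumes "A \<in> carrier_mat nr nc" "v \<in> carrier_vec nc"
  shows "(k \<cdot>\<^sub>m A) *\<^sub>v v = k \<cdot>\<^sub>v (A *\<^sub>v v)"
  using assms by (intro eq_vecI) (auto simp: scalar_prod_def sum_distrib_left mult.assoc)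

lemma smult_mat_pow:
  fixes k :: "'a::comm_semiring_1"
  assumes "A \<in> carrier_mat n n"
  shows "(k \<cdot>\<^sub>m A) ^\<^sub>m r = k ^ r \<cdot>\<^sub>m (A ^\<^sub>m r)"
proof (induction r)
  case (Suc r)
  have "A ^\<^sub>m r \<in> carrier_mat n n" using assms by simp
  with Suc assms show ?case
    by (intro eq_matI) (auto simp: scalar_prod_def sum_distrib_left mult_ac)
qed (use assms in auto)

lemma det_nonzero_if_no_eigenvalue_0:
  fixes A :: "'a::field mat"
  assumes A: "A \<in> carrier_mat n n" and "\<not> eigenvalue A 0"
  shows "det A \<noteq> 0"
proof
  assume "det A = 0"
  then obtain v where "v \<in> carrier_vec n" "v \<noteq> 0\<^sub>v n" "A *\<^sub>v v = 0\<^sub>v n"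
    unfolding det_0_iff_vec_prod_zero[OF A] by blast
  then have "eigenvector A v 0" using A unfolding eigenvector_def by auto
  with assms(2) show False unfolding eigenvalue_def by blast
qed

lemma two_sided_inverse_exists:
  fixes A :: "'a::field mat"
  assumes A: "A \<in> carrier_mat n n" and "det A \<noteq> 0"
  obtains B where "B \<in> carrier_mat n n" "B * A = 1\<^sub>m n" "A * B = 1\<^sub>m n"
proof
  let ?B = "inverse (det A) \<cdot>\<^sub>m adj_mat A"
  show "?B \<in> carrier_mat n n" using adj_mat(1)[OF A] by simp
  show "?B * A = 1\<^sub>m n"
    using assms(2) by (simp add: mult_smult_assoc_mat[OF adj_mat(1)[OF A] A] adj_mat(3)[OF A])
       (auto intro!: eq_matI)
  show "A * ?B = 1\<^sub>m n"
    using assms(2) by (simp add: mult_smult_distrib[OF A adj_mat(1)[OF A]] adj_mat(2)[OF A])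
       (auto intro!: eq_matI)
qed

text \<open>Choose \<open>t\<close> between the spectral radius and 1. Then \<open>C\<close>, which
  is \<open>B\<close> divided by \<open>t\<close>, has spectral radius below 1, so its powers are
  bounded by some \<open>K\<close> and those of \<open>B\<close> by
  \<open>K * t ^ r\<close>.\<close>

lemma contracting_power:
  fixes B :: "complex mat"
  assumes B: "B \<in> carrier_mat n n" and ev: "\<And>l. eigenvalue B l \<Longrightarrow> cmod l < 1" and "\<epsilon> > 0"
  shows "\<exists>r>0. norm_bound (B ^\<^sub>m r) \<epsilon>"
proof (cases "n = 0")
  \<comment> \<open>Without rows the spectrum is empty and has no maximum, so this case is
    separate.\<close>
  case True
  with B show ?thesis by (intro exI[of _ 1]) (auto simp: norm_bound_def)
next
  case False
  then have n: "n > 0" by simp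
  have rho: "spectral_radius B < 1" "spectral_radius B \<ge> 0"
    using spectral_radius_mem_max(1)[OF B n] ev by (auto simp: spectrum_def)
  then obtain t where t: "spectral_radius B < t" "t < 1" using dense by blast
  with rho have t0: "t > 0" by simp
  define C where "C = of_real (1 / t) \<cdot>\<^sub>m B"
  have C: "C \<in> carrier_mat n n" using B by (simp add: C_def)
  have "cmod l < 1" if l: "eigenvalue C l" for l
  proof -
    obtain v where v: "v \<in> carrier_vec n" "v \<noteq> 0\<^sub>v n" "C *\<^sub>v v = l \<cdot>\<^sub>v v"
      using l unfolding eigenvalue_def eigenvector_def carrier_matD(1)[OF C] by blast
    have "of_real t \<cdot>\<^sub>v (of_real (1 / t) \<cdot>\<^sub>v (B *\<^sub>v v)) = of_real t \<cdot>\<^sub>v (l \<cdot>\<^sub>v v)"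
      using v(3) by (simp only: C_def smult_mat_mult_vec[OF B v(1)])
    then have "B *\<^sub>v v = (of_real t * l) \<cdot>\<^sub>v v"
      using t0 by (simp add: smult_smult_assoc flip: of_real_mult)
    then have "eigenvalue B (of_real t * l)"
      using v B unfolding eigenvalue_def eigenvector_def by auto
    then have "cmod (of_real t * l) \<le> spectral_radius B"
      by (intro spectral_radius_mem_max(2)[OF B n]) (auto simp: spectrum_def)
    then show ?thesis using t t0 by (simp add: norm_mult) (smt (verit) mult_le_cancel_left1)
  qed
  then have "spectral_radius C < 1"
    using spectral_radius_mem_max(1)[OF C n] by (auto simp: spectrum_def)
  then obtain K where K: "\<And>r. norm_bound (C ^\<^sub>m r) K"
    using spectral_radius_jnf_norm_bound_less_1_upper_triangular[OF C] by blast
  have "(\<lambda>r. K * t ^ r) \<longlonglongrightarrow> 0"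
    using tendsto_mult_right_zero[OF LIMSEQ_power_zero[of t]] t t0 by simp
  then have "eventually (\<lambda>r. K * t ^ r < \<epsilon>) sequentially"
    using order_tendstoD(2) \<open>\<epsilon> > 0\<close> by blast
  then obtain r0 where "\<forall>r\<ge>r0. K * t ^ r < \<epsilon>" unfolding eventually_sequentially by blast
  \<comment> \<open>The successor ensures a positive exponent.\<close>
  then have "K * t ^ Suc r0 < \<epsilon>" by (meson le_SucI order_refl)
  then obtain r where r: "r > 0" "K * t ^ r < \<epsilon>" using zero_less_Suc by blast
  have "cmod ((B ^\<^sub>m r) $$ (i, j)) \<le> \<epsilon>" if "i < n" "j < n" for i j
  proof -
    have "cmod ((C ^\<^sub>m r) $$ (i, j)) \<le> K"
      using K[of r] C that unfolding norm_bound_def by simp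
    then have "(1 / t) ^ r * cmod ((B ^\<^sub>m r) $$ (i, j)) \<le> K"
      using that B t0 by (simp add: C_def smult_mat_pow[OF B] norm_mult norm_power norm_divide)
    then have "cmod ((B ^\<^sub>m r) $$ (i, j)) \<le> K * t ^ r"
      using t0 by (simp add: field_simps)
    with r show ?thesis by simp
  qed
  then show ?thesis using r B by (intro exI[of _ r]) (auto simp: norm_bound_def)
qed

text \<open>As 0 is not an eigenvalue, \<open>A\<close> is invertible, and the eigenvalues of its
  inverse are reciprocals of eigenvalues of \<open>A\<close>.\<close>

lemma expanding_inverse:
  fixes A :: "complex mat"
  assumes A: "A \<in> carrier_mat n n" and ev: "\<And>l. eigenvalue A l \<Longrightarrow> cmod l > 1" and "\<epsilon> > 0"
  shows "\<exists>B r. B \<in> carrier_mat n n \<and> B * A = 1\<^sub>m n \<and> r > 0 \<and> norm_bound (B ^\<^sub>m r) \<epsilon>"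
proof -
  have "det A \<noteq> 0" using det_nonzero_if_no_eigenvalue_0[OF A] ev[of 0] by auto
  then obtain B where B: "B \<in> carrier_mat n n" "B * A = 1\<^sub>m n" "A * B = 1\<^sub>m n"
    using two_sided_inverse_exists[OF A] by blast
  have "cmod l < 1" if l: "eigenvalue B l" for l
  proof -
    obtain v where v: "v \<in> carrier_vec n" "v \<noteq> 0\<^sub>v n" "B *\<^sub>v v = l \<cdot>\<^sub>v v"
      using l B(1) unfolding eigenvalue_def eigenvector_def by auto
    have "v = (A * B) *\<^sub>v v" using v(1) B(3) by simp
    also have "\<dots> = l \<cdot>\<^sub>v (A *\<^sub>v v)"
      using A B(1) v by (simp add: mult_mat_vec[OF A v(1)])
    finally have eq: "v = l \<cdot>\<^sub>v (A *\<^sub>v v)" .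
    have l0: "l \<noteq> 0"
    proof
      assume "l = 0"
      have "v = 0\<^sub>v n"
        by (subst eq, unfold \<open>l = 0\<close>) (use A in \<open>auto intro!: eq_vecI\<close>)
      with v(2) show False by simp
    qed
    have "inverse l \<cdot>\<^sub>v v = inverse l \<cdot>\<^sub>v (l \<cdot>\<^sub>v (A *\<^sub>v v))" by (rule arg_cong[OF eq])
    then have "A *\<^sub>v v = inverse l \<cdot>\<^sub>v v" using l0 by (simp add: smult_smult_assoc)
    then have "eigenvalue A (inverse l)"
      using v A unfolding eigenvalue_def eigenvector_def by auto
    from ev[OF this] l0 show ?thesis by (simp add: norm_inverse one_less_inverse_iff)
  qed
  from contracting_power[OF B(1) this \<open>\<epsilon> > 0\<close>] B show ?thesis by blast
qed

section \<open>Cokernels, the coordinate norm and both directions of the equivalence\<close>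

lemma additive_funpow: "additive F \<Longrightarrow> additive (F ^^ n)" for F :: "'a::ab_group_add \<Rightarrow> 'a"
  by (induction n) (simp_all add: additive_def)

lemma subspace_range:
  assumes "additive F" shows "int_module.subspace (range F)"
proof (rule int_module.subspaceI)
  show "0 \<in> range F" using additive.zero[OF assms] by (metis rangeI)
qed (auto simp flip: additive.add[OF assms] additive_int_scale[OF assms])

text \<open>One factor \<open>k\<close> per application: if \<open>int_scale (k ^ n) a\<close> is
  the \<open>n\<close>-fold image of \<open>y\<close>, a further factor \<open>k\<close> turns
  \<open>y\<close> into an image under \<open>F\<close>.\<close>

lemma int_scale_power_in_range_funpow:
  fixes F :: "'a::ab_group_add \<Rightarrow> 'a"
  assumes F: "additive F" and k: "\<And>a. int_scale k a \<in> range F"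
  shows "int_scale (k ^ n) a \<in> range (F ^^ n)"
proof (induction n)
  case (Suc n)
  then obtain y where y: "int_scale (k ^ n) a = (F ^^ n) y" by blast
  obtain z where z: "int_scale k y = F z" using k by blast
  have "int_scale (k ^ Suc n) a = (F ^^ n) (int_scale k y)"
    by (simp add: additive_int_scale[OF additive_funpow[OF F]] flip: y)
  also have "\<dots> = (F ^^ Suc n) z" by (simp add: z funpow_swap1)
  finally show ?case by blast
qed simp

context integral_coordinates
begin

text \<open>
  Multiplying the integer matrix of \<open>F\<close> by its adjugate puts \<open>det\<close> times each basis element into
  the range of \<open>F\<close>, and \<open>m\<close> moves every element into the span of the basis.
\<close>
lemma bounded_cokernel:
  assumes F: "additive F" and det: "det (coord_mat F) \<noteq> 0"
  shows "\<exists>k>0. \<forall>a. int_scale k a \<in> range F"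
proof -
  define C where "C = mat d d (\<lambda>(i, j). c i (F (b j)))"
  have C: "C \<in> carrier_mat d d" by (simp add: C_def)
  \<comment> \<open>Up to the factor \<open>m\<close>, \<open>C\<close> is the matrix of
    \<open>F\<close>, so its determinant is nonzero too.\<close>
  have "map_mat of_int C = of_int m \<cdot>\<^sub>m coord_mat F"
    using m_pos by (intro eq_matI) (auto simp: C_def coord_mat_def)
  then have "complex_of_int (det C) = of_int m ^ d * det (coord_mat F)"
    using of_int_hom.hom_det[of C, where ?'a = complex] by (simp add: coord_mat_def)
  with det m_pos have det_C: "det C \<noteq> 0" by auto
  note sub = subspace_range[OF F]
  let ?D = "adj_mat C"
  have D: "?D \<in> carrier_mat d d" by (rule adj_mat(1)[OF C])
  have b: "int_scale (det C) (b k) \<in> range F" if k: "k < d" for k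
  proof -
    have "F (\<Sum>j<d. int_scale (?D $$ (j, k)) (int_scale m (b j)))
        = (\<Sum>j<d. int_scale (?D $$ (j, k)) (int_scale m (F (b j))))"
      by (simp only: additive.sum[OF F] additive_int_scale[OF F])
    also have "\<dots> = (\<Sum>j<d. \<Sum>i<d. int_scale (C $$ (i, j) * ?D $$ (j, k)) (b i))"
      unfolding expand
      by (intro sum.cong refl) (simp add: int_module.scale_sum_right C_def mult.commute)
    also have "\<dots> = (\<Sum>i<d. int_scale (\<Sum>j<d. C $$ (i, j) * ?D $$ (j, k)) (b i))"
      by (subst sum.swap) (simp add: int_module.scale_sum_left)
    also have "\<dots> = (\<Sum>i<d. int_scale ((C * ?D) $$ (i, k)) (b i))"
      using C D k by (intro sum.cong refl) (simp add: scalar_prod_def atLeast0LessThan)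
    also have "\<dots> = (\<Sum>i<d. if i = k then int_scale (det C) (b i) else 0)"
      unfolding adj_mat(2)[OF C] using k by (intro sum.cong refl) auto
    also have "\<dots> = int_scale (det C) (b k)" using k by simp
    finally show ?thesis by (metis rangeI)
  qed
  have "int_scale (\<bar>det C\<bar> * m) a \<in> range F" for a
  proof -
    have "int_scale (\<bar>det C\<bar> * m) a = int_scale (sgn (det C) * det C) (int_scale m a)"
      by (simp add: abs_sgn mult.commute)
    also have "\<dots> = (\<Sum>i<d. int_scale (sgn (det C) * c i a) (int_scale (det C) (b i)))"
      unfolding expand by (simp add: int_module.scale_sum_right mult_ac)
    also have "\<dots> \<in> range F"
      by (intro int_module.subspace_sum[OF sub] int_module.subspace_scale[OF sub] b) simp
    finally show ?thesis .
  qed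
  then show ?thesis using det_C m_pos by (intro exI[of _ "\<bar>det C\<bar> * m"]) simp
qed

definition coord_norm :: "'g \<Rightarrow> real" where
  "coord_norm a = (\<Sum>i<d. \<bar>real_of_int (c i a)\<bar>)"

lemma coords_funpow:
  assumes F: "additive F" and B: "B \<in> carrier_mat d d" "B * coord_mat F = 1\<^sub>m d"
  shows "coords a = B ^\<^sub>m r *\<^sub>v coords ((F ^^ r) a)"
proof (induction r)
  case 0
  then show ?case using B(1) by simp
next
  case (Suc r)
  have "coords ((F ^^ r) a) = (B * coord_mat F) *\<^sub>v coords ((F ^^ r) a)"
    unfolding B(2) by simp
  also have "\<dots> = B *\<^sub>v coords ((F ^^ Suc r) a)"
    by (simp add: assoc_mult_mat_vec[OF B(1) coord_mat_carrier coords_carrier] coords_image[OF F])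
  finally have "B ^\<^sub>m r *\<^sub>v coords ((F ^^ r) a) = B ^\<^sub>m r *\<^sub>v (B *\<^sub>v coords ((F ^^ Suc r) a))"
    by simp
  also have "\<dots> = B ^\<^sub>m Suc r *\<^sub>v coords ((F ^^ Suc r) a)"
    using assoc_mult_mat_vec[OF pow_carrier_mat[OF B(1)] B(1) coords_carrier] by simp
  finally show ?case using Suc by simp
qed

text \<open>Each coordinate of \<open>a\<close> is a row of \<open>B ^\<^sub>m r\<close> applied to
  the image, hence at most \<open>\<epsilon>\<close> times its norm; summing over the rows gives the
  factor \<open>d\<close>.\<close>

lemma coord_norm_expand:
  assumes F: "additive F" and B: "B \<in> carrier_mat d d" "B * coord_mat F = 1\<^sub>m d"
    and bound: "norm_bound (B ^\<^sub>m r) \<epsilon>"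
  shows "coord_norm a \<le> real d * \<epsilon> * coord_norm ((F ^^ r) a)"
proof -
  let ?y = "(F ^^ r) a"
  have "\<bar>real_of_int (c i a)\<bar> \<le> \<epsilon> * coord_norm ?y" if i: "i < d" for i
  proof -
    have "of_int (c i a) = (B ^\<^sub>m r *\<^sub>v coords ?y) $ i"
      unfolding coords_funpow[OF F B, of a r, symmetric] using i by (simp add: coords_def)
    also have "\<dots> = (\<Sum>j<d. (B ^\<^sub>m r) $$ (i, j) * of_int (c j ?y))"
      using i B(1) by (simp add: coords_def scalar_prod_def atLeast0LessThan)
    finally have "cmod (of_int (c i a)) \<le> (\<Sum>j<d. cmod ((B ^\<^sub>m r) $$ (i, j) * of_int (c j ?y)))"
      by (simp only: norm_sum)
    also have "\<dots> \<le> (\<Sum>j<d. \<epsilon> * \<bar>real_of_int (c j ?y)\<bar>)"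
      using bound i B(1) by (intro sum_mono) (auto simp: norm_mult norm_bound_def intro!: mult_right_mono)
    finally show ?thesis by (simp add: coord_norm_def sum_distrib_left)
  qed
  then have "coord_norm a \<le> (\<Sum>i<d. \<epsilon> * coord_norm ?y)"
    unfolding coord_norm_def[of a] by (intro sum_mono) simp
  then show ?thesis by (simp add: mult.assoc)
qed

lemma expanding_length_coord_norm:
  assumes "additive G" and "\<And>a. 6 * coord_norm a \<le> coord_norm (G a)"
  shows "expanding_length G coord_norm"
proof
  fix a b :: 'g and R :: real
  show "coord_norm (a + b) \<le> coord_norm a + coord_norm b"
    unfolding coord_norm_def sum.distrib[symmetric]
    by (intro sum_mono) (simp add: additive.add[OF additive_c])
  show "coord_norm (- a) = coord_norm a"
    by (simp add: coord_norm_def additive.minus[OF additive_c])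
  \<comment> \<open>The coordinates are integers, so a real bound may be rounded down.\<close>
  have "\<bar>c i a\<bar> \<le> \<lfloor>R\<rfloor>" if "coord_norm a \<le> R" "i < d" for a i
  proof -
    have "\<bar>real_of_int (c i a)\<bar> \<le> coord_norm a"
      unfolding coord_norm_def using that(2) by (intro member_le_sum) auto
    with that(1) show ?thesis by (simp add: le_floor_iff)
  qed
  then show "finite {a. coord_norm a \<le> R}"
    by (intro finite_subset[OF _ finite_ball[of "\<lfloor>R\<rfloor>"]]) blast
qed (use assms in \<open>simp_all add: additive.add\<close>)

lemma spanning_set_exists:
  assumes fg: "finitely_generated TYPE('g)" and F: "additive F"
    and ev: "\<And>l. eigenvalue (coord_mat F) l \<Longrightarrow> cmod l > 1"
  shows "\<exists>r>0. \<exists>S. spanning_set (F ^^ r) S"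
proof -
  \<comment> \<open>Chosen to make \<open>6 * d * \<epsilon>\<close> at most 1; the summand 1 keeps
    the denominator nonzero for \<open>d = 0\<close>.\<close>
  let ?\<epsilon> = "1 / (6 * (real d + 1))"
  obtain B r where B: "B \<in> carrier_mat d d" "B * coord_mat F = 1\<^sub>m d" "r > 0"
      "norm_bound (B ^\<^sub>m r) ?\<epsilon>"
    using expanding_inverse[OF coord_mat_carrier[of F] ev, where \<epsilon> = ?\<epsilon>] by auto
  note G = additive_funpow[OF F, of r]
  have nonneg: "coord_norm a \<ge> 0" for a by (simp add: coord_norm_def sum_nonneg)
  have "6 * coord_norm a \<le> coord_norm ((F ^^ r) a)" for a
  proof -
    have "6 * coord_norm a \<le> 6 * (d * ?\<epsilon>) * coord_norm ((F ^^ r) a)"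
      using coord_norm_expand[OF F B(1,2,4), of a] by simp
    also have "\<dots> \<le> 1 * coord_norm ((F ^^ r) a)"
      using nonneg by (intro mult_right_mono) (auto simp: divide_simps)
    finally show ?thesis by simp
  qed
  then interpret expanding_length "F ^^ r" coord_norm
    by (rule expanding_length_coord_norm[OF G])
  have "det (coord_mat F) \<noteq> 0"
    using det_nonzero_if_no_eigenvalue_0[OF coord_mat_carrier] ev[of 0] by auto
  then obtain k where k: "k > 0" "\<And>a. int_scale k a \<in> range F"
    using bounded_cokernel[OF F] by blast
  obtain E where E: "finite E" "\<And>a. \<exists>e\<in>E. a - e \<in> range (F ^^ r)"
    using finitely_generated_remainders[OF fg subspace_range[OF G], of "k ^ r"]
      int_scale_power_in_range_funpow[OF F k(2)] k(1) by auto
  \<comment> \<open>Large enough for the ball to contain all of \<open>E\<close>, and so a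
    representative of each coset of the range.\<close>
  let ?R = "\<Sum>e\<in>E. coord_norm e"
  have "coord_norm e \<le> ?R" if "e \<in> E" for e
    using that E(1) nonneg by (intro member_le_sum) auto
  then have "spanning_set (F ^^ r) {a. coord_norm a \<le> ?R}"
    using E(2) by (intro spanning_set_ball) (blast, simp add: sum_nonneg nonneg)
  with \<open>r > 0\<close> show ?thesis by blast
qed

text \<open>An eigenfunctional of \<open>F\<close> for \<open>l\<close> is one of
  \<open>F ^^ r\<close> for \<open>l ^ r\<close>; if \<open>l\<close> had modulus at most 1, so
  would \<open>l ^ r\<close>, and the functional would vanish.\<close>

lemma eigenvalue_norm_gt_1:
  assumes F: "additive F" and S: "spanning_set (F ^^ r) S" and l: "eigenvalue (coord_mat F) l"
  shows "cmod l > 1"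
proof (rule ccontr)
  assume "\<not> ?thesis"
  then have le: "cmod (l ^ r) \<le> 1" by (simp add: norm_power power_le_one)
  obtain \<phi> :: "'g \<Rightarrow> complex" where \<phi>: "additive \<phi>" "\<And>a. \<phi> (F a) = l * \<phi> a" "\<exists>a. \<phi> a \<noteq> 0"
    using eigenfunctional_exists[OF F l] by blast
  have "\<phi> ((F ^^ r) a) = l ^ r * \<phi> a" for a
    by (induction r) (simp_all add: \<phi>(2))
  with spanning_set_eigenfunctional_eq_0[OF S additive_funpow[OF F] \<phi>(1) _ le] \<phi>(3) show False
    by blast
qed

end

theorem theorem3p11:
  fixes F :: "'g::ab_group_add \<Rightarrow> 'g"
  assumes "infinite (UNIV :: 'g set)"
    and "finitely_generated TYPE('g)"
    and "additive F"
    and "inj F"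
  shows "(\<exists>r>0. \<exists>S. spanning_set (F ^^ r) S) \<longleftrightarrow>
    (\<forall>l. is_eigenvalue scale_complexification (complexification_map F) l \<longrightarrow> cmod l > 1)"
proof -
  obtain d m and b :: "nat \<Rightarrow> 'g" and c where "integral_coordinates d m b c"
    using finitely_generated_integral_coordinates[OF assms(2)] by blast
  then interpret integral_coordinates d m b c .
  show ?thesis
    unfolding is_eigenvalue_iff_coord_mat[OF assms(3)]
    using spanning_set_exists[OF assms(2,3)] eigenvalue_norm_gt_1[OF assms(3)] by blast
qed

end
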